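(* Let $X$ be a real reflexive Banach space that is continuously and densely embedded into a real Hilbert space $H$, with embedding operator $i:X\to H$, and assume that $X$ is not isomorphic to a Hilbert space. Then for every $\varepsilon>0$ there exists $x\in X$ such that $$\|i(x)\|_H^2<\varepsilon\,\|i^\ast(i(x))\|_{X^\ast}\,\|x\|_X .$$
   Context: "Isomorphic" means linearly homeomorphic. $X$ is continuously and densely embedded into $H$ via $i$ means that $i:X\to H$ is an injective bounded linear operator with $i(X)$ dense in $H$. $H$ is identified with its dual $H^\ast$ via the Riesz representation, so the adjoint of $i$ is regarded as the map $i^\ast:H\to X^\ast$ given by $\langle i^\ast(h),y\rangle=(h,i(y))_H$ for $h\in H$, $y\in X$, where $(\cdot,\cdot)_H$ is the inner product of $H$ and $\langle\cdot,\cdot\rangle$ is the duality product between $X^\ast$ and $X$. *)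

theory Defs
  imports "HOL-Analysis.Analysis"
begin

definition bidual_embedding ::
    "'a::real_normed_vector \<Rightarrow> (('a \<Rightarrow>\<^sub>L real) \<Rightarrow>\<^sub>L real)" where
  "bidual_embedding x = Blinfun (\<lambda>f. blinfun_apply f x)"

lemma bidual_embedding_apply: "blinfun_apply (bidual_embedding x) f = blinfun_apply f x"
  unfolding bidual_embedding_def
  by (simp add: bounded_linear_Blinfun_apply blinfun.bounded_linear_left)

definition reflexive_space :: "'a::banach itself \<Rightarrow> bool" where
  "reflexive_space _ \<longleftrightarrow>
     surj (bidual_embedding :: 'a \<Rightarrow> (('a \<Rightarrow>\<^sub>L real) \<Rightarrow>\<^sub>L real))"

(* The adjoint of i, with H identified with its dual via the Riesz representation. *)
definition riesz_adjoint ::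
    "('a::real_normed_vector \<Rightarrow>\<^sub>L 'h::real_inner) \<Rightarrow> 'h \<Rightarrow> ('a \<Rightarrow>\<^sub>L real)" where
  "riesz_adjoint i h = Blinfun (\<lambda>y. inner h (blinfun_apply i y))"

lemma riesz_adjoint_apply:
  "blinfun_apply (riesz_adjoint i h) y = inner h (blinfun_apply i y)"
  unfolding riesz_adjoint_def
  by (subst bounded_linear_Blinfun_apply)
     (auto intro: bounded_linear_inner_right_comp blinfun.bounded_linear_right)

(* HOL cannot quantify over types inside a formula, so "there is a Hilbert space K" is a
   quantification over Hilbert space structures: the operations of the type classes
   real_inner and complete_space, subject to exactly the axioms of these classes.
   All structures live on the underlying type of the given space, with operations
   unrelated to the given ones.  This loses no K: a space isomorphic to the given one is
   in bijection with it, so it has a copy with this underlying type; see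
   isomorphic_to_hilbert_spaceI below.  The operations minusK, ..., openK are determined by
   plusK, scaleK and innerK through the class axioms. *)
definition isomorphic_to_hilbert_space :: "'a::real_normed_vector itself \<Rightarrow> bool" where
  "isomorphic_to_hilbert_space _ \<longleftrightarrow>
     (\<exists>(minusK :: 'a \<Rightarrow> 'a \<Rightarrow> 'a) distK normK plusK zeroK uminusK scaleK sgnK
         uniformityK openK innerK (T :: 'a \<Rightarrow> 'a).
        class.real_inner minusK distK normK plusK zeroK uminusK scaleK sgnK
          uniformityK openK innerK \<and>
        class.complete_space distK uniformityK openK \<and>
        (\<forall>x y. T (x + y) = plusK (T x) (T y)) \<and>
        (\<forall>r x. T (r *\<^sub>R x) = scaleK r (T x)) \<and>
        homeomorphic_map euclidean (topology openK) T)"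

lemma isomorphic_to_hilbert_spaceI:
  fixes T :: "'a::real_normed_vector \<Rightarrow> 'k::{real_inner, complete_space}"
  assumes "linear T" and "homeomorphism UNIV UNIV T S"
  shows "isomorphic_to_hilbert_space TYPE('a)"
proof -
  have ST [simp]: "S (T x) = x" and TS [simp]: "T (S y) = y" for x y
    using assms(2) by (auto simp: homeomorphism_def)
  have Teq: "T x = T y \<longleftrightarrow> x = y" for x y by (metis ST)
  have inT: "T x \<in> T ` U \<longleftrightarrow> x \<in> U" for x U by (auto simp: Teq)
  have allT: "(\<forall>y. P y) \<longleftrightarrow> (\<forall>x. P (T x))" for P
    by (rule iffI, blast, metis TS)
  have opn: "open (T ` U) \<longleftrightarrow> open U" for U
    using homeomorphism_imp_open_map[OF assms(2)]
      homeomorphism_imp_open_map[OF homeomorphism_symD[OF assms(2)], of "T ` U"]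
    by (auto simp: image_image)
  define d n sg where "d = (\<lambda>x y. dist (T x) (T y))" and "n = (\<lambda>x. norm (T x))"
    and "sg = (\<lambda>x. inverse (norm (T x)) *\<^sub>R x)"
  define u where "u = (INF e\<in>{0<..}. principal {(x, y). d x y < e})"
  define ip where "ip = (\<lambda>x y. inner (T x) (T y))"
  have ev: "eventually P u \<longleftrightarrow> (\<exists>e>0. \<forall>x y. d x y < e \<longrightarrow> P (x, y))" for P
  proof -
    have "\<exists>x\<in>{0<..}. principal {(x', y). d x' y < x}
            \<le> inf (principal {(x, y). d x y < a}) (principal {(x, y). d x y < b})"
      if "a \<in> {0<..}" "b \<in> {0<..}" for a b
      using that by (intro bexI[of _ "min a b"]) auto
    then show ?thesis
      unfolding u_def
      by (subst eventually_INF_base) (auto simp: eventually_principal)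
  qed
  have openU: "class.open_uniformity open u"
  proof
    fix U :: "'a set"
    have "open U \<longleftrightarrow> open (T ` U)"
      by (simp add: opn)
    also have "\<dots> \<longleftrightarrow> (\<forall>x\<in>U. \<exists>e>0. \<forall>y'. dist y' (T x) < e \<longrightarrow> y' \<in> T ` U)"
      by (simp add: open_dist)
    also have "\<dots> \<longleftrightarrow> (\<forall>x\<in>U. \<exists>e>0. \<forall>x'. dist (T x') (T x) < e \<longrightarrow> x' \<in> U)"
    proof -
      have all: "(\<forall>y'. dist y' (T x) < e \<longrightarrow> y' \<in> T ` U)
          \<longleftrightarrow> (\<forall>x'. dist (T x') (T x) < e \<longrightarrow> x' \<in> U)" for x e
        using allT[of "\<lambda>y'. dist y' (T x) < e \<longrightarrow> y' \<in> T ` U"] by (simp add: inT)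
      show ?thesis by (simp only: all)
    qed
    also have "\<dots> \<longleftrightarrow> (\<forall>x\<in>U. \<forall>\<^sub>F (x', y) in u. x' = x \<longrightarrow> y \<in> U)"
    proof -
      have "(\<forall>x'. dist (T x') (T x) < e \<longrightarrow> x' \<in> U)
          \<longleftrightarrow> (\<forall>x' y. d x' y < e \<longrightarrow> x' = x \<longrightarrow> y \<in> U)" for x e
        by (auto simp: d_def dist_commute)
      then show ?thesis by (simp add: ev)
    qed
    finally show "open U \<longleftrightarrow> (\<forall>x\<in>U. \<forall>\<^sub>F (x', y) in u. x' = x \<longrightarrow> y \<in> U)" .
  qed
  have unif: "class.uniformity_dist d u" by standard (rule u_def)
  have met: "class.metric_space d u open"
    by (intro class.metric_space.intro unif openU class.metric_space_axioms.intro)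
       (auto simp: d_def Teq dist_triangle2)
  have inn: "class.real_inner (-) d n (+) 0 uminus scaleR sg u open ip"
  proof (intro class.real_inner.intro unif openU)
    show "class.dist_norm (-) d n"
      by standard (simp add: d_def n_def dist_norm linear_diff[OF assms(1)])
    show "class.real_vector (+) (0::'a) (-) uminus scaleR"
      by (rule real_vector_class.real_vector_axioms)
    show "class.sgn_div_norm sg n scaleR"
      by standard (simp add: sg_def n_def)
    have "T x = 0 \<longleftrightarrow> x = 0" for x
      using Teq[of x 0] by (simp add: linear_0[OF assms(1)])
    then show "class.real_inner_axioms n (+) 0 scaleR ip"
      by unfold_locales
         (simp_all add: n_def ip_def linear_add[OF assms(1)] linear_scale[OF assms(1)]
           inner_commute inner_add_left inner_add_right norm_eq_sqrt_inner)
  qed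
  have comp: "class.complete_space d u open"
  proof (intro class.complete_space.intro met class.complete_space_axioms.intro)
    fix X :: "nat \<Rightarrow> 'a"
    assume "uniform_space.Cauchy u X"
    then have C: "\<forall>e>0. \<exists>N. \<forall>m\<ge>N. \<forall>n\<ge>N. d (X m) (X n) < e"
      using metric_space.Cauchy_def[OF met] by blast
    have "Cauchy (\<lambda>k. T (X k))"
      unfolding Cauchy_def using C by (simp add: d_def)
    then obtain l where l: "(\<lambda>k. T (X k)) \<longlonglongrightarrow> l"
      using Cauchy_convergent convergent_def by blast
    have "continuous (at l) S"
      using assms(2) by (auto simp: homeomorphism_def continuous_on_eq_continuous_at)
    from continuous_within_tendsto_compose'[OF this _ l] have "X \<longlonglongrightarrow> S l"
      by simp
    then show "topological_space.convergent open X"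
      unfolding topological_space.convergent_def[OF topological_space_class.topological_space_axioms]
        topological_space.nhds_def[OF topological_space_class.topological_space_axioms]
        nhds_def[symmetric]
      by blast
  qed
  have "homeomorphic_map euclidean (topology open) (\<lambda>x::'a. x)"
    using homeomorphic_map_id[of euclidean euclidean] by (simp add: id_def)
  with inn comp show ?thesis
    unfolding isomorphic_to_hilbert_space_def
    by (intro exI[of _ "(-)"] exI[of _ d] exI[of _ n] exI[of _ "(+)"] exI[of _ 0]
        exI[of _ uminus] exI[of _ scaleR] exI[of _ sg] exI[of _ u] exI[of _ "open"]
        exI[of _ ip] exI[of _ "\<lambda>x. x"]) simp
qed

end

theory Submission
  imports Defs
begin

text \<open>
  Write \<open>A = i\<^sup>* i\<close>, so that \<open>\<langle>A x, x\<rangle> = (norm (i x))\<^sup>2\<close>; the claim is that \<open>x\<close> and \<open>A x\<close> can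
  be made almost orthogonal relative to their norms. The key is that \<open>i\<close> is not bounded below:
  otherwise its range would be complete, hence closed, hence all of \<open>H\<close> by density, and \<open>i\<close>
  itself would be an isomorphism of \<open>X\<close> onto the Hilbert space \<open>H\<close>
  (\<open>bounded_below_dense_imp_isomorphic_to_hilbert_space\<close>).

  So there are vectors \<open>x\<close> of arbitrarily large norm on which \<open>i\<close>, and therefore also \<open>A\<close>, is
  as small as desired. Adding such an \<open>x\<close> to a fixed \<open>u \<noteq> 0\<close> changes \<open>i u\<close> and \<open>A u\<close> only
  slightly, and \<open>A u \<noteq> 0\<close>, while the norm of \<open>u + x\<close> exceeds any given bound. Along these
  vectors the left-hand side of the claimed inequality stays bounded and the right-hand side is
  unbounded (\<open>not_bounded_below_imp_small_quotient\<close>).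
\<close>

lemma riesz_adjoint_add: "riesz_adjoint i (g + h) = riesz_adjoint i g + riesz_adjoint i h"
  by (rule blinfun_eqI) (simp add: riesz_adjoint_apply blinfun.add_left inner_add_left)

lemma norm_riesz_adjoint_le: "norm (riesz_adjoint i h) \<le> norm i * norm h"
proof (rule norm_blinfun_bound)
  fix y
  have "norm (blinfun_apply (riesz_adjoint i h) y) \<le> norm h * norm (blinfun_apply i y)"
    by (simp add: riesz_adjoint_apply Cauchy_Schwarz_ineq2)
  also have "\<dots> \<le> norm h * (norm i * norm y)"
    by (intro mult_left_mono norm_blinfun) simp
  finally show "norm (blinfun_apply (riesz_adjoint i h) y) \<le> norm i * norm h * norm y"
    by (simp add: ac_simps)
qed simp

lemma riesz_adjoint_range_eq_0_iff:
  "riesz_adjoint i (blinfun_apply i x) = 0 \<longleftrightarrow> blinfun_apply i x = 0"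
proof
  assume "riesz_adjoint i (blinfun_apply i x) = 0"
  then have "inner (blinfun_apply i x) (blinfun_apply i x) = 0"
    by (metis riesz_adjoint_apply zero_blinfun.rep_eq)
  then show "blinfun_apply i x = 0" by simp
next
  assume "blinfun_apply i x = 0"
  then show "riesz_adjoint i (blinfun_apply i x) = 0"
    by (intro blinfun_eqI) (simp add: riesz_adjoint_apply)
qed

text \<open>
  The lower bound makes the inverse of \<open>i\<close> Lipschitz and turns Cauchy sequences in the range
  into Cauchy sequences of preimages, so completeness of \<open>X\<close> passes to the range.
\<close>
lemma bounded_below_dense_imp_isomorphic_to_hilbert_space:
  fixes i :: "'a::banach \<Rightarrow>\<^sub>L 'h::{real_inner, complete_space}"
  assumes "\<delta> > 0" and below: "\<And>x. \<delta> * norm x \<le> norm (blinfun_apply i x)"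
    and dense: "closure (range (blinfun_apply i)) = UNIV"
  shows "isomorphic_to_hilbert_space TYPE('a)"
proof -
  have lower: "dist x y \<le> dist (blinfun_apply i x) (blinfun_apply i y) / \<delta>" for x y
    using below[of "x - y"] \<open>\<delta> > 0\<close> by (simp add: dist_norm blinfun.diff_right field_simps)
  have "complete (range (blinfun_apply i))"
    by (rule complete_isometric_image[OF \<open>\<delta> > 0\<close> subspace_UNIV blinfun.bounded_linear_right])
       (use below complete_UNIV in auto)
  then have surj: "surj (blinfun_apply i)"
    using dense complete_imp_closed closure_closed by metis
  have inj: "inj (blinfun_apply i)"
  proof (rule injI)
    fix x y assume "blinfun_apply i x = blinfun_apply i y"
    then show "x = y" using lower[of x y] by simp
  qed
  have "homeomorphism UNIV UNIV (blinfun_apply i) (inv (blinfun_apply i))"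
  proof (rule homeomorphismI)
    have "(1 / \<delta>)-lipschitz_on UNIV (inv (blinfun_apply i))"
    proof (rule lipschitz_onI)
      fix g h
      show "dist (inv (blinfun_apply i) g) (inv (blinfun_apply i) h) \<le> 1 / \<delta> * dist g h"
        using lower[of "inv (blinfun_apply i) g" "inv (blinfun_apply i) h"]
        by (simp add: surj_f_inv_f[OF surj])
    qed (use \<open>\<delta> > 0\<close> in simp)
    then show "continuous_on UNIV (inv (blinfun_apply i))"
      by (rule lipschitz_on_continuous_on)
  qed (auto simp: inj surj surj_f_inv_f intro: linear_continuous_on blinfun.bounded_linear_right)
  then show ?thesis
    using isomorphic_to_hilbert_spaceI blinfun.bounded_linear_right bounded_linear.linear by blast
qed

lemma not_bounded_below_imp_large_preimage:
  fixes i :: "'a::real_normed_vector \<Rightarrow>\<^sub>L 'b::real_normed_vector"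
  assumes inj: "inj (blinfun_apply i)"
    and not_below: "\<And>\<delta>. \<delta> > 0 \<Longrightarrow> \<exists>x. norm (blinfun_apply i x) < \<delta> * norm x"
    and "\<eta> > 0" "R > 0"
  obtains x where "norm (blinfun_apply i x) = \<eta>" "norm x > R"
proof -
  obtain y where y: "norm (blinfun_apply i y) < \<eta> / R * norm y"
    using not_below[of "\<eta> / R"] \<open>\<eta> > 0\<close> \<open>R > 0\<close> by auto
  then have "y \<noteq> 0" by auto
  then have pos: "norm (blinfun_apply i y) > 0"
    using inj by (metis blinfun.zero_right injD zero_less_norm_iff)
  define x where "x = (\<eta> / norm (blinfun_apply i y)) *\<^sub>R y"
  have "norm (blinfun_apply i x) = \<eta>" "norm x > R"
    using pos y \<open>\<eta> > 0\<close> \<open>R > 0\<close> by (simp_all add: x_def blinfun.scaleR_right field_simps)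
  then show thesis by (rule that)
qed

text \<open>
  The witness is \<open>u + x\<close>, where \<open>u \<noteq> 0\<close> is fixed and \<open>x\<close> is a long vector with short image:
  the summand \<open>u\<close> keeps the norm of \<open>i\<^sup>* i (u + x)\<close> away from zero, the summand \<open>x\<close> makes the
  norm of \<open>u + x\<close> large.
\<close>
lemma not_bounded_below_imp_small_quotient:
  fixes i :: "'a::real_normed_vector \<Rightarrow>\<^sub>L 'h::real_inner"
  assumes inj: "inj (blinfun_apply i)"
    and not_below: "\<And>\<delta>. \<delta> > 0 \<Longrightarrow> \<exists>x. norm (blinfun_apply i x) < \<delta> * norm x"
    and "\<epsilon> > 0"
  shows "\<exists>x. (norm (blinfun_apply i x))\<^sup>2
           < \<epsilon> * norm (riesz_adjoint i (blinfun_apply i x)) * norm x"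
proof -
  let ?A = "\<lambda>x. riesz_adjoint i (blinfun_apply i x)"
  obtain u where "norm (blinfun_apply i u) < 1 * norm u"
    using not_below[of 1] by auto
  then have "blinfun_apply i u \<noteq> 0"
    using inj by (metis blinfun.zero_right injD less_irrefl mult_1 norm_zero)
  then have a: "norm (?A u) > 0"
    by (simp add: riesz_adjoint_range_eq_0_iff)
  \<comment> \<open>\<open>\<eta>\<close> is so small that an image of norm \<open>\<eta>\<close> moves \<open>?A u\<close> by at most half its norm;
      the summand \<open>1\<close> only avoids a division by zero.\<close>
  define \<eta> where "\<eta> = norm (?A u) / (2 * (norm i + 1))"
  have "\<eta> > 0"
    using a by (simp add: \<eta>_def add_nonneg_pos)
  have "norm i * \<eta> \<le> (norm i + 1) * \<eta>"
    using \<open>\<eta> > 0\<close> by simp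
  also have "\<dots> = norm (?A u) / 2"
    using norm_ge_zero[of i] by (simp add: \<eta>_def field_simps add_nonneg_eq_0_iff)
  finally have \<eta>: "norm i * \<eta> \<le> norm (?A u) / 2" .
  define M where "M = (norm (blinfun_apply i u) + \<eta>)\<^sup>2"
  define r where "r = M / (\<epsilon> * (norm (?A u) / 2))"
  have "M \<ge> 0" by (simp add: M_def)
  then have "r \<ge> 0" using a \<open>\<epsilon> > 0\<close> by (simp add: r_def)
  have "r + norm u + 1 > 0" using \<open>r \<ge> 0\<close> by (simp add: add_nonneg_pos)
  then obtain x where x: "norm (blinfun_apply i x) = \<eta>" "norm x > r + norm u + 1"
    using not_bounded_below_imp_large_preimage[OF inj not_below \<open>\<eta> > 0\<close>] by blast
  have "norm (blinfun_apply i (u + x)) \<le> norm (blinfun_apply i u) + \<eta>"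
    using norm_triangle_ineq[of "blinfun_apply i u" "blinfun_apply i x"] x(1)
    by (simp add: blinfun.add_right)
  then have "(norm (blinfun_apply i (u + x)))\<^sup>2 \<le> M"
    unfolding M_def by (intro power_mono) auto
  also have "M = \<epsilon> * (norm (?A u) / 2) * r"
    using a \<open>\<epsilon> > 0\<close> by (simp add: r_def)
  also have "\<dots> < \<epsilon> * (norm (?A u) / 2) * norm (u + x)"
  proof (rule mult_strict_left_mono)
    show "r < norm (u + x)"
      using norm_diff_ineq[of x u] x(2) by (simp add: add.commute)
  qed (use a \<open>\<epsilon> > 0\<close> in simp)
  also have "\<dots> \<le> \<epsilon> * norm (?A (u + x)) * norm (u + x)"
  proof -
    have "norm (?A x) \<le> norm (?A u) / 2"
      using norm_riesz_adjoint_le[of i "blinfun_apply i x"] x(1) \<eta> by simp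
    then have "norm (?A u) / 2 \<le> norm (?A (u + x))"
      using norm_diff_ineq[of "?A u" "?A x"] by (simp add: blinfun.add_right riesz_adjoint_add)
    then show ?thesis
      using \<open>\<epsilon> > 0\<close> by (intro mult_right_mono mult_left_mono) auto
  qed
  finally show ?thesis by blast
qed

theorem proposition4p10:
  fixes i :: "'a::banach \<Rightarrow>\<^sub>L 'h::{real_inner, complete_space}"
    and \<epsilon> :: real
  assumes "reflexive_space TYPE('a)"
    and "inj (blinfun_apply i)"
    and "closure (range (blinfun_apply i)) = UNIV"
    and "\<not> isomorphic_to_hilbert_space TYPE('a)"
    and "\<epsilon> > 0"
  shows "\<exists>x. (norm (blinfun_apply i x))\<^sup>2
           < \<epsilon> * norm (riesz_adjoint i (blinfun_apply i x)) * norm x"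
proof (rule not_bounded_below_imp_small_quotient[OF assms(2) _ assms(5)])
  fix \<delta> :: real assume "\<delta> > 0"
  then show "\<exists>x. norm (blinfun_apply i x) < \<delta> * norm x"
    using bounded_below_dense_imp_isomorphic_to_hilbert_space[of \<delta> i] assms(3,4)
    by (meson not_le)
qed

end
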